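(* Let $1\le d\le n-1$. The polynomial $$\left(\frac{\sigma_{d,n}(x)}{\binom{n}{d}}\right)^2-\left(\frac{\sigma_{d+1,n}(x)}{\binom{n}{d+1}}\right)\cdot\left(\frac{\sigma_{d-1,n}(x)}{\binom{n}{d-1}}\right)$$ is a sum of squares of polynomials in $\mathbb{R}[x_1,\dots,x_n]$.
   Context: $\sigma_{d,n}\in\mathbb{R}[x_1,\dots,x_n]$ denotes the elementary symmetric polynomial of degree $d$ in $n$ variables, with $\sigma_{0,n}=1$. *)

theory Defs
  imports Complex_Main "HOL-Library.Poly_Mapping"
begin

text \<open>
  A real polynomial in the variables \<open>x\<^sub>1, x\<^sub>2, \<dots>\<close> is a finitely supported map from monomials to
  coefficients; a monomial is a finitely supported map from variable indices to exponents.
  The ring operations are those of \<^theory>\<open>HOL-Library.Poly_Mapping\<close> (convolution product).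
\<close>

type_synonym real_mpoly = "(nat \<Rightarrow>\<^sub>0 nat) \<Rightarrow>\<^sub>0 real"

definition Const :: "real \<Rightarrow> real_mpoly" where
  "Const c = Poly_Mapping.single 0 c"

definition Var :: "nat \<Rightarrow> real_mpoly" where
  "Var i = Poly_Mapping.single (Poly_Mapping.single i 1) 1"

text \<open>The subring \<open>\<real>[x\<^sub>1, \<dots>, x\<^sub>n]\<close>: only the variables with index in \<open>{1..n}\<close> occur.\<close>

definition polys :: "nat \<Rightarrow> real_mpoly set" where
  "polys n = {p. \<forall>m \<in> Poly_Mapping.keys p. Poly_Mapping.keys m \<subseteq> {1..n}}"

definition esym :: "nat \<Rightarrow> nat \<Rightarrow> real_mpoly" where
  "esym d n = (\<Sum>S | S \<subseteq> {1..n} \<and> card S = d. \<Prod>i\<in>S. Var i)"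

definition sum_of_squares :: "nat \<Rightarrow> real_mpoly \<Rightarrow> bool" where
  "sum_of_squares n p \<longleftrightarrow>
     (\<exists>(k::nat) q. (\<forall>i<k. q i \<in> polys n) \<and> p = (\<Sum>i<k. (q i)\<^sup>2))"

lemma esym_0: "esym 0 n = 1"
proof -
  have "{S. S \<subseteq> {1..n} \<and> card S = 0} = {{}}"
    by (auto dest: finite_subset)
  then show ?thesis
    by (simp add: esym_def)
qed

end

theory Submission imports Defs
begin

text \<open>
  Write \<open>x\<^sup>S\<close> for the product of the variables indexed by \<open>S\<close>. Moving one element of \<open>A - B\<close> from
  \<open>A\<close> to \<open>B\<close> turns \<open>\<sigma>\<^sub>d\<^sub>+\<^sub>1 \<sigma>\<^sub>d\<^sub>-\<^sub>1\<close> into a quadratic form in the \<open>x\<^sup>S\<close>, \<open>card S = d\<close>, so that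
  \<open>\<sigma>\<^sub>d\<^sup>2 - \<sigma>\<^sub>d\<^sub>+\<^sub>1 \<sigma>\<^sub>d\<^sub>-\<^sub>1\<close> has the Gram matrix \<open>1 / (d + 1 - card (S \<inter> T))\<close>.
  This matrix is positive semidefinite because \<open>(d + 1) / (d + 1 - k)\<close> is the sum over \<open>j \<le> d\<close> of
  \<open>(k choose j) / (d choose j)\<close>, and \<open>card (S \<inter> T) choose j\<close> counts the \<open>j\<close>-sets \<open>R\<close> contained in
  both \<open>S\<close> and \<open>T\<close>. With \<open>P\<^sub>R\<close> the sum of the \<open>x\<^sup>S\<close> over \<open>S \<supseteq> R\<close>, the form is thus a positive
  combination of the \<open>P\<^sub>R\<^sup>2\<close>. Replacing each \<open>P\<^sub>R\<close> by its deviation from the mean over all \<open>j\<close>-sets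
  \<open>R\<close> splits off a multiple of \<open>\<sigma>\<^sub>d\<^sup>2\<close>, which cancels exactly against the contribution of the
  normalising binomial coefficients.
\<close>

section \<open>Constants and closure properties of \<open>polys n\<close>\<close>

lemma Const_0 [simp]: "Const 0 = 0"
  by (simp add: Const_def)

lemma Const_1 [simp]: "Const 1 = 1"
  by (simp add: Const_def)

lemma Const_add: "Const (a + b) = Const a + Const b"
  by (simp add: Const_def single_add)

lemma Const_diff: "Const (a - b) = Const a - Const b"
  by (simp add: Const_def single_diff)

lemma Const_mult: "Const (a * b) = Const a * Const b"
  by (simp add: Const_def mult_single)

lemma Const_sum: "Const (\<Sum>i\<in>A. f i) = (\<Sum>i\<in>A. Const (f i))"
  by (induction A rule: infinite_finite_induct) (simp_all add: Const_add)

lemma Const_of_nat: "Const (real m) = of_nat m"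
  by (induction m) (simp_all add: Const_add)

lemma Const_in_polys [simp]: "Const c \<in> polys n"
  by (simp add: polys_def Const_def)

lemma Var_in_polys: "i \<in> {1..n} \<Longrightarrow> Var i \<in> polys n"
  by (simp add: polys_def Var_def)

lemma polys_diff: "p \<in> polys n \<Longrightarrow> q \<in> polys n \<Longrightarrow> p - q \<in> polys n"
  using keys_diff[of p q] by (fastforce simp: polys_def)

lemma polys_add: "p \<in> polys n \<Longrightarrow> q \<in> polys n \<Longrightarrow> p + q \<in> polys n"
  using Poly_Mapping.keys_add[of p q] by (fastforce simp: polys_def)

lemma polys_mult:
  assumes "p \<in> polys n" "q \<in> polys n"
  shows "p * q \<in> polys n"
  unfolding polys_def
proof (intro CollectI ballI)
  fix m assume "m \<in> Poly_Mapping.keys (p * q)"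
  then obtain a b where "m = a + b" "a \<in> Poly_Mapping.keys p" "b \<in> Poly_Mapping.keys q"
    using keys_mult[of p q] by blast
  then show "Poly_Mapping.keys m \<subseteq> {1..n}"
    using assms Poly_Mapping.keys_add[of a b] by (fastforce simp: polys_def)
qed

lemma polys_sum: "(\<And>i. i \<in> A \<Longrightarrow> f i \<in> polys n) \<Longrightarrow> (\<Sum>i\<in>A. f i) \<in> polys n"
  using Const_in_polys[of 0 n]
  by (induction A rule: infinite_finite_induct) (simp_all add: polys_add)

lemma polys_prod: "(\<And>i. i \<in> A \<Longrightarrow> f i \<in> polys n) \<Longrightarrow> (\<Prod>i\<in>A. f i) \<in> polys n"
  using Const_in_polys[of 1 n]
  by (induction A rule: infinite_finite_induct) (simp_all add: polys_mult)

section \<open>Sums of squares with nonnegative weights\<close>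

lemma sum_of_squares_0: "sum_of_squares n 0"
  unfolding sum_of_squares_def by (rule exI[of _ 0]) simp

lemma sum_of_squares_add_square:
  assumes "sum_of_squares n p" "r \<in> polys n"
  shows "sum_of_squares n (p + r\<^sup>2)"
proof -
  obtain k :: nat and q where q: "\<forall>i<k. q i \<in> polys n" "p = (\<Sum>i<k. (q i)\<^sup>2)"
    using assms(1) unfolding sum_of_squares_def by blast
  have "p + r\<^sup>2 = (\<Sum>i<Suc k. ((q(k := r)) i)\<^sup>2)"
    using q(2) by simp
  moreover have "\<forall>i<Suc k. (q(k := r)) i \<in> polys n"
    using q(1) assms(2) by (auto simp: less_Suc_eq)
  ultimately show ?thesis
    unfolding sum_of_squares_def by blast
qed

text \<open>A nonnegative real weight is absorbed by scaling the squared polynomial by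
  \<open>sqrt (w i)\<close>.\<close>

lemma sum_of_squares_weighted_sum:
  assumes "finite A" "\<And>i. i \<in> A \<Longrightarrow> 0 \<le> w i" "\<And>i. i \<in> A \<Longrightarrow> q i \<in> polys n"
  shows "sum_of_squares n (\<Sum>i\<in>A. Const (w i) * (q i)\<^sup>2)"
  using assms
proof (induction A rule: finite_induct)
  case empty
  then show ?case
    by (simp add: sum_of_squares_0)
next
  case (insert a A)
  have "Const (w a) * (q a)\<^sup>2 = (Const (sqrt (w a)) * q a)\<^sup>2"
    using insert.prems(1)[of a]
    by (simp add: power_mult_distrib power2_eq_square flip: Const_mult)
  moreover have "Const (sqrt (w a)) * q a \<in> polys n"
    using insert.prems(2) by (simp add: polys_mult)
  ultimately show ?case
    using insert sum_of_squares_add_square[of n "\<Sum>i\<in>A. Const (w i) * (q i)\<^sup>2"]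
    by (simp add: add.commute)
qed

text \<open>Trinomial revision turns each term with \<open>j \<le> k\<close> into
  \<open>((d - j) choose (k - j)) / (d choose k)\<close>, and summing along a diagonal gives
  \<open>(Suc d choose k) / (d choose k)\<close>. The identity serves twice: for the Gram matrix
  entries, and with \<open>d\<close>, \<open>n\<close> in place of \<open>k\<close>,
  \<open>d\<close> for the split-off multiple of the square of \<open>esym d n\<close>.\<close>

lemma sum_choose_ratio:
  assumes "k \<le> d"
  shows "(\<Sum>j\<le>d. real (k choose j) / real (d choose j)) = real (d + 1) / real (d + 1 - k)"
proof -
  have "(\<Sum>j\<le>d. real (k choose j) / real (d choose j))
      = (\<Sum>j\<le>k. real (k choose j) / real (d choose j))"
    using assms by (intro sum.mono_neutral_right) (auto simp: not_le)
  also have "\<dots> = (\<Sum>j\<le>k. real ((d - j) choose (k - j)) / real (d choose k))"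
  proof (rule sum.cong)
    fix j assume "j \<in> {..k}"
    then have "(d choose k) * (k choose j) = (d choose j) * ((d - j) choose (k - j))"
      using assms by (simp add: choose_mult)
    then have "real (d choose k) * real (k choose j) = real (d choose j) * real ((d - j) choose (k - j))"
      by (metis of_nat_mult)
    moreover have "d choose k \<noteq> 0" "d choose j \<noteq> 0"
      using assms \<open>j \<in> {..k}\<close> by auto
    ultimately show "real (k choose j) / real (d choose j) = real ((d - j) choose (k - j)) / real (d choose k)"
      by (simp add: field_simps)
  qed simp
  also have "\<dots> = real (\<Sum>j\<le>k. (d - j) choose (k - j)) / real (d choose k)"
    by (simp add: sum_divide_distrib)
  also have "(\<Sum>j\<le>k. (d - j) choose (k - j)) = Suc d choose k"
    using sum_choose_diagonal[OF assms] by simp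
  also have "real (Suc d choose k) / real (d choose k) = real (d + 1) / real (d + 1 - k)"
  proof -
    have "(d + 1 - k) * (Suc d choose k) = (d + 1) * (d choose k)"
      using binomial_absorb_comp[of "Suc d" k] by simp
    then have "real (d + 1 - k) * real (Suc d choose k) = real (d + 1) * real (d choose k)"
      by (metis of_nat_mult)
    moreover have "d choose k \<noteq> 0" "d + 1 - k \<noteq> 0"
      using assms by auto
    ultimately show ?thesis
      by (simp add: field_simps)
  qed
  finally show ?thesis .
qed

section \<open>Squarefree monomials and double counting over subsets\<close>

definition subsets_of_card :: "nat \<Rightarrow> nat \<Rightarrow> nat set set" where
  "subsets_of_card d n = {S. S \<subseteq> {1..n} \<and> card S = d}"

definition sqfree_monom :: "nat set \<Rightarrow> real_mpoly" where
  "sqfree_monom S = (\<Prod>i\<in>S. Var i)"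

text \<open>This is \<open>P\<^sub>R\<close>. The \<open>if\<close> keeps the index set independent
  of \<open>R\<close>, so that sums over \<open>R\<close> and \<open>S\<close> can be swapped
  directly.\<close>

definition esym_above :: "nat \<Rightarrow> nat \<Rightarrow> nat set \<Rightarrow> real_mpoly" where
  "esym_above d n R = (\<Sum>S\<in>subsets_of_card d n. if R \<subseteq> S then sqfree_monom S else 0)"

lemma finite_subsets_of_card [simp]: "finite (subsets_of_card d n)"
  by (simp add: subsets_of_card_def)

lemma card_subsets_of_card: "card (subsets_of_card d n) = n choose d"
  using n_subsets[of "{1..n}" d] by (simp add: subsets_of_card_def)

lemma subsets_of_cardD:
  assumes "S \<in> subsets_of_card d n"
  shows "S \<subseteq> {1..n}" "card S = d" "finite S"
  using assms by (auto simp: subsets_of_card_def intro: finite_subset)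

lemma esym_eq: "esym d n = (\<Sum>S\<in>subsets_of_card d n. sqfree_monom S)"
  by (simp add: esym_def subsets_of_card_def sqfree_monom_def)

lemma sqfree_monom_in_polys: "S \<in> subsets_of_card d n \<Longrightarrow> sqfree_monom S \<in> polys n"
  unfolding sqfree_monom_def by (intro polys_prod Var_in_polys) (use subsets_of_cardD(1) in fast)

lemma esym_in_polys: "esym d n \<in> polys n"
  unfolding esym_eq by (intro polys_sum sqfree_monom_in_polys)

lemma esym_above_in_polys: "esym_above d n R \<in> polys n"
  unfolding esym_above_def using Const_in_polys[of 0 n]
  by (intro polys_sum) (auto intro: sqfree_monom_in_polys)

lemma card_subsets_of_card_below:
  assumes "U \<subseteq> {1..n}"
  shows "card {R \<in> subsets_of_card j n. R \<subseteq> U} = card U choose j"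
proof -
  have "{R \<in> subsets_of_card j n. R \<subseteq> U} = {R. R \<subseteq> U \<and> card R = j}"
    using assms by (auto simp: subsets_of_card_def)
  then show ?thesis
    using n_subsets[of U j] finite_subset[OF assms] by simp
qed

lemma sum_subsets_of_card_below:
  fixes c :: real_mpoly
  assumes "U \<subseteq> {1..n}"
  shows "(\<Sum>R\<in>subsets_of_card j n. if R \<subseteq> U then c else 0) = Const (real (card U choose j)) * c"
  using card_subsets_of_card_below[OF assms, of j]
  by (simp add: Const_of_nat flip: sum.inter_filter)

text \<open>Each \<open>S\<close> of size \<open>d\<close> contains \<open>d choose j\<close> of the
  sets \<open>R\<close>. Dividing by the number \<open>n choose j\<close> of sets \<open>R\<close>
  gives the mean that is subtracted later.\<close>

lemma sum_esym_above:
  "(\<Sum>R\<in>subsets_of_card j n. esym_above d n R) = Const (real (d choose j)) * esym d n"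
proof -
  have "(\<Sum>R\<in>subsets_of_card j n. esym_above d n R)
      = (\<Sum>S\<in>subsets_of_card d n. \<Sum>R\<in>subsets_of_card j n. if R \<subseteq> S then sqfree_monom S else 0)"
    unfolding esym_above_def by (rule sum.swap)
  also have "\<dots> = (\<Sum>S\<in>subsets_of_card d n. Const (real (d choose j)) * sqfree_monom S)"
    by (intro sum.cong refl) (metis sum_subsets_of_card_below subsets_of_cardD(1,2))
  finally show ?thesis
    by (simp only: esym_eq sum_distrib_left)
qed

text \<open>The product for \<open>S\<close> and \<open>T\<close> occurs exactly when
  \<open>R \<subseteq> S \<inter> T\<close>, so its coefficient counts the \<open>j\<close>-subsets
  of the intersection.\<close>

lemma sum_esym_above_square:
  "(\<Sum>R\<in>subsets_of_card j n. (esym_above d n R)\<^sup>2)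
     = (\<Sum>S\<in>subsets_of_card d n. \<Sum>T\<in>subsets_of_card d n.
         Const (real (card (S \<inter> T) choose j)) * (sqfree_monom S * sqfree_monom T))"
proof -
  let ?D = "subsets_of_card d n"
  have "(\<Sum>R\<in>subsets_of_card j n. (esym_above d n R)\<^sup>2)
      = (\<Sum>R\<in>subsets_of_card j n. \<Sum>S\<in>?D. \<Sum>T\<in>?D.
          if R \<subseteq> S \<inter> T then sqfree_monom S * sqfree_monom T else 0)"
    unfolding esym_above_def power2_eq_square sum_product
    by (intro sum.cong refl) auto
  also have "\<dots> = (\<Sum>S\<in>?D. \<Sum>R\<in>subsets_of_card j n. \<Sum>T\<in>?D.
          if R \<subseteq> S \<inter> T then sqfree_monom S * sqfree_monom T else 0)"
    by (rule sum.swap)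
  also have "\<dots> = (\<Sum>S\<in>?D. \<Sum>T\<in>?D. \<Sum>R\<in>subsets_of_card j n.
          if R \<subseteq> S \<inter> T then sqfree_monom S * sqfree_monom T else 0)"
    by (rule sum.cong[OF refl], rule sum.swap)
  also have "\<dots> = (\<Sum>S\<in>?D. \<Sum>T\<in>?D.
          Const (real (card (S \<inter> T) choose j)) * (sqfree_monom S * sqfree_monom T))"
    using subsets_of_cardD(1)
    by (intro sum.cong refl sum_subsets_of_card_below) fast
  finally show ?thesis .
qed

section \<open>The Gram form: positivity and relation to \<open>esym\<close>\<close>

definition gram_form :: "nat \<Rightarrow> nat \<Rightarrow> real_mpoly" where
  "gram_form d n = (\<Sum>S\<in>subsets_of_card d n. \<Sum>T\<in>subsets_of_card d n.
     Const (1 / real (d + 1 - card (S \<inter> T))) * (sqfree_monom S * sqfree_monom T))"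

text \<open>Each matrix entry is expanded by \<open>sum_choose_ratio\<close> with
  \<open>k = card (S \<inter> T)\<close>; moving the sum over \<open>j\<close> outside leaves
  squares with positive weights.\<close>

lemma gram_form_eq:
  "gram_form d n = (\<Sum>j\<le>d. Const (1 / (real (d + 1) * real (d choose j)))
     * (\<Sum>R\<in>subsets_of_card j n. (esym_above d n R)\<^sup>2))"
proof -
  let ?D = "subsets_of_card d n"
  have coeff: "Const (1 / real (d + 1 - card (S \<inter> T)))
      = (\<Sum>j\<le>d. Const (1 / (real (d + 1) * real (d choose j))) * Const (real (card (S \<inter> T) choose j)))"
    if "S \<in> ?D" "T \<in> ?D" for S T
  proof -
    have "card (S \<inter> T) \<le> d"
      using that subsets_of_cardD card_mono by (metis inf_le1)
    from sum_choose_ratio[OF this]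
    have "1 / real (d + 1 - card (S \<inter> T))
        = (\<Sum>j\<le>d. real (card (S \<inter> T) choose j) / real (d choose j)) / real (d + 1)"
      by simp
    also have "\<dots> = (\<Sum>j\<le>d. 1 / (real (d + 1) * real (d choose j)) * real (card (S \<inter> T) choose j))"
      by (simp add: sum_divide_distrib mult.commute)
    finally show ?thesis
      by (simp only: Const_sum Const_mult)
  qed
  have "gram_form d n = (\<Sum>S\<in>?D. \<Sum>T\<in>?D. \<Sum>j\<le>d. Const (1 / (real (d + 1) * real (d choose j)))
      * (Const (real (card (S \<inter> T) choose j)) * (sqfree_monom S * sqfree_monom T)))"
    unfolding gram_form_def
    by (intro sum.cong refl) (simp only: coeff sum_distrib_right mult.assoc)
  also have "\<dots> = (\<Sum>S\<in>?D. \<Sum>j\<le>d. \<Sum>T\<in>?D. Const (1 / (real (d + 1) * real (d choose j)))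
      * (Const (real (card (S \<inter> T) choose j)) * (sqfree_monom S * sqfree_monom T)))"
    by (intro sum.cong refl, rule sum.swap)
  also have "\<dots> = (\<Sum>j\<le>d. \<Sum>S\<in>?D. \<Sum>T\<in>?D. Const (1 / (real (d + 1) * real (d choose j)))
      * (Const (real (card (S \<inter> T) choose j)) * (sqfree_monom S * sqfree_monom T)))"
    by (rule sum.swap)
  finally show ?thesis
    by (simp only: sum_esym_above_square sum_distrib_left)
qed

text \<open>Each product for \<open>(A, B)\<close> is split into equal shares, one for every
  \<open>i \<in> A - B\<close>, and the share of \<open>i\<close> is assigned to the pair
  \<open>(A - {i}, insert i B)\<close> of \<open>d\<close>-sets. Collecting the shares by target
  pair gives the coefficients on the right.\<close>

lemma esym_mult_neighbours:
  assumes "1 \<le> d"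
  shows "esym (d + 1) n * esym (d - 1) n = (esym d n)\<^sup>2 - gram_form d n"
proof -
  let ?D = "subsets_of_card"
  let ?x = sqfree_monom
  define Z1 where "Z1 = (SIGMA p:?D (d + 1) n \<times> ?D (d - 1) n. fst p - snd p)"
  define Z2 where "Z2 = (SIGMA p:?D d n \<times> ?D d n. snd p - fst p)"
  \<comment> \<open>The share does not depend on \<open>i\<close>, and one formula serves both
    \<open>Z1\<close> and \<open>Z2\<close> because the move preserves the intersection and the
    product of the monomials.\<close>
  define f where "f = (\<lambda>((S, T), i::nat). Const (1 / real (d + 1 - card (S \<inter> T))) * (?x S * ?x T))"
  have fin: "finite (A - B)" if "A \<in> ?D k n" for A B k
    using subsets_of_cardD(3)[OF that] by simp
  have "esym (d + 1) n * esym (d - 1) n = (\<Sum>(A, B)\<in>?D (d + 1) n \<times> ?D (d - 1) n. ?x A * ?x B)"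
    by (simp add: esym_eq sum_product sum.cartesian_product)
  also have "\<dots> = (\<Sum>p\<in>?D (d + 1) n \<times> ?D (d - 1) n. \<Sum>i\<in>fst p - snd p. f (p, i))"
  proof (intro sum.cong refl, clarify)
    fix A B assume AB: "A \<in> ?D (d + 1) n" "B \<in> ?D (d - 1) n"
    have c: "card (A - B) = d + 1 - card (A \<inter> B)"
      using AB card_Diff_subset_Int[of A B] subsets_of_cardD by (metis finite_Int)
    \<comment> \<open>Hence \<open>A - B\<close> has at least two elements, so the equal shares
      exist and add up to the whole.\<close>
    moreover have "card (A \<inter> B) \<le> d - 1"
      using AB subsets_of_cardD card_mono by (metis inf_le2)
    ultimately have "real (card (A - B)) \<noteq> 0"
      using assms by simp
    then have "of_nat (card (A - B)) * Const (1 / real (card (A - B))) = 1"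
      by (simp flip: Const_of_nat Const_mult)
    then show "?x A * ?x B = (\<Sum>i\<in>fst (A, B) - snd (A, B). f ((A, B), i))"
      by (simp add: f_def c flip: mult.assoc)
  qed
  also have "\<dots> = (\<Sum>z\<in>Z1. f z)"
    unfolding Z1_def by (subst sum.Sigma) (auto simp: fin)
  also have "\<dots> = (\<Sum>z\<in>Z2. f z)"
  proof (rule sum.reindex_bij_witness[where
        i = "\<lambda>((S, T), i). ((insert i S, T - {i}), i)" and
        j = "\<lambda>((A, B), i). ((A - {i}, insert i B), i)"])
    fix z assume "z \<in> Z1"
    then obtain A B i where z: "z = ((A, B), i)" and
      AB: "A \<in> ?D (d + 1) n" "B \<in> ?D (d - 1) n" "i \<in> A" "i \<notin> B"
      by (auto simp: Z1_def)
    note A = subsets_of_cardD[OF AB(1)] and B = subsets_of_cardD[OF AB(2)]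
    show "(\<lambda>((S, T), i). ((insert i S, T - {i}), i)) ((\<lambda>((A, B), i). ((A - {i}, insert i B), i)) z) = z"
      using z AB by auto
    show "(\<lambda>((A, B), i). ((A - {i}, insert i B), i)) z \<in> Z2"
      using z AB A B assms by (auto simp: Z2_def subsets_of_card_def)
    have "(A - {i}) \<inter> insert i B = A \<inter> B"
      using AB by auto
    moreover have "?x (A - {i}) * ?x (insert i B) = ?x A * ?x B"
      using AB A B by (simp add: sqfree_monom_def prod.remove[of A i] mult_ac)
    ultimately show "f ((\<lambda>((A, B), i). ((A - {i}, insert i B), i)) z) = f z"
      by (simp add: z f_def)
  next
    fix z assume "z \<in> Z2"
    then obtain S T i where z: "z = ((S, T), i)" and
      ST: "S \<in> ?D d n" "T \<in> ?D d n" "i \<notin> S" "i \<in> T"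
      by (auto simp: Z2_def)
    note S = subsets_of_cardD[OF ST(1)] and T = subsets_of_cardD[OF ST(2)]
    show "(\<lambda>((A, B), i). ((A - {i}, insert i B), i)) ((\<lambda>((S, T), i). ((insert i S, T - {i}), i)) z) = z"
      using z ST by auto
    show "(\<lambda>((S, T), i). ((insert i S, T - {i}), i)) z \<in> Z1"
      using z ST S T assms by (auto simp: Z1_def subsets_of_card_def)
  qed
  also have "\<dots> = (\<Sum>p\<in>?D d n \<times> ?D d n. \<Sum>i\<in>snd p - fst p. f (p, i))"
    unfolding Z2_def by (subst sum.Sigma) (auto simp: fin)
  also have "\<dots> = (\<Sum>(S, T)\<in>?D d n \<times> ?D d n.
      ?x S * ?x T - Const (1 / real (d + 1 - card (S \<inter> T))) * (?x S * ?x T))"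
  proof (intro sum.cong refl, clarify)
    fix S T assume ST: "S \<in> ?D d n" "T \<in> ?D d n"
    have k: "card (S \<inter> T) \<le> d"
      using ST subsets_of_cardD card_mono by (metis inf_le1)
    \<comment> \<open>With \<open>k = card (S \<inter> T)\<close>, the pair receives
      \<open>d - k\<close> shares of size \<open>1 / (d + 1 - k)\<close>, one fewer than would make
      a whole; the missing share is the Gram entry.\<close>
    have "card (T - S) = d - card (S \<inter> T)"
      using ST card_Diff_subset_Int[of T S] subsets_of_cardD by (metis finite_Int Int_commute)
    then have "real (card (T - S)) * (1 / real (d + 1 - card (S \<inter> T)))
        = 1 - 1 / real (d + 1 - card (S \<inter> T))"
      using k by (simp add: of_nat_diff field_simps)
    then have "of_nat (card (T - S)) * Const (1 / real (d + 1 - card (S \<inter> T)))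
        = 1 - Const (1 / real (d + 1 - card (S \<inter> T)))"
      by (metis Const_1 Const_diff Const_mult Const_of_nat)
    then show "(\<Sum>i\<in>snd (S, T) - fst (S, T). f ((S, T), i))
        = ?x S * ?x T - Const (1 / real (d + 1 - card (S \<inter> T))) * (?x S * ?x T)"
      by (simp add: f_def left_diff_distrib flip: mult.assoc)
  qed
  also have "\<dots> = (esym d n)\<^sup>2 - gram_form d n"
    by (simp add: gram_form_def esym_eq power2_eq_square sum_product sum.cartesian_product
        split_def sum_subtractf)
  finally show ?thesis .
qed

section \<open>Variance decomposition around the mean\<close>

lemma sum_esym_above_deviation:
  assumes "j \<le> n"
  shows "(\<Sum>R\<in>subsets_of_card j n. (esym_above d n R)\<^sup>2)
    = (\<Sum>R\<in>subsets_of_card j n.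
         (esym_above d n R - Const (real (d choose j) / real (n choose j)) * esym d n)\<^sup>2)
      + Const ((real (d choose j))\<^sup>2 / real (n choose j)) * (esym d n)\<^sup>2"
proof -
  let ?J = "subsets_of_card j n" and ?P = "esym_above d n" and ?s = "esym d n"
  \<comment> \<open>By \<open>sum_esym_above\<close>, \<open>Const m * ?s\<close> is the mean of
    \<open>?P R\<close> over \<open>?J\<close>.\<close>
  define m where "m = real (d choose j) / real (n choose j)"
  have "n choose j \<noteq> 0"
    using assms by simp
  \<comment> \<open>The cross term subtracts this common value twice and the squared mean adds it
    once, so one copy remains subtracted.\<close>
  then have m: "m * real (d choose j) = (real (d choose j))\<^sup>2 / real (n choose j)"
    "real (n choose j) * (m * m) = (real (d choose j))\<^sup>2 / real (n choose j)"
    by (simp_all add: m_def power2_eq_square)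
  have "(\<Sum>R\<in>?J. (?P R - Const m * ?s)\<^sup>2)
      = (\<Sum>R\<in>?J. (?P R)\<^sup>2 - 2 * (Const m * ?s) * ?P R + Const m * Const m * ?s\<^sup>2)"
    by (intro sum.cong refl) (simp add: power2_eq_square algebra_simps)
  also have "\<dots> = (\<Sum>R\<in>?J. (?P R)\<^sup>2) - 2 * (Const m * ?s) * (\<Sum>R\<in>?J. ?P R)
      + of_nat (n choose j) * (Const m * Const m * ?s\<^sup>2)"
    by (simp add: sum.distrib sum_subtractf card_subsets_of_card flip: sum_distrib_left)
  also have "\<dots> = (\<Sum>R\<in>?J. (?P R)\<^sup>2) - 2 * (Const (m * real (d choose j)) * ?s\<^sup>2)
      + Const (real (n choose j) * (m * m)) * ?s\<^sup>2"
    by (simp add: sum_esym_above Const_mult power2_eq_square mult_ac flip: Const_of_nat)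
  finally show ?thesis
    by (simp add: m flip: m_def)
qed

lemma gram_form_deviation:
  assumes "d \<le> n"
  shows "gram_form d n
    = (\<Sum>(j, R)\<in>(SIGMA j:{..d}. subsets_of_card j n). Const (1 / (real (d + 1) * real (d choose j)))
        * (esym_above d n R - Const (real (d choose j) / real (n choose j)) * esym d n)\<^sup>2)
      + Const (real (n + 1) / (real (d + 1) * real (n + 1 - d))) * (esym d n)\<^sup>2"
proof -
  define c where "c = (\<lambda>j. 1 / (real (d + 1) * real (d choose j)))"
  define V where "V = (\<lambda>j. \<Sum>R\<in>subsets_of_card j n.
      (esym_above d n R - Const (real (d choose j) / real (n choose j)) * esym d n)\<^sup>2)"
  have "gram_form d n = (\<Sum>j\<le>d. Const (c j) * (\<Sum>R\<in>subsets_of_card j n. (esym_above d n R)\<^sup>2))"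
    by (simp only: gram_form_eq c_def)
  also have "\<dots> = (\<Sum>j\<le>d. Const (c j) * V j
      + Const (c j * ((real (d choose j))\<^sup>2 / real (n choose j))) * (esym d n)\<^sup>2)"
    using assms unfolding Const_mult
    by (intro sum.cong refl) (simp add: sum_esym_above_deviation V_def distrib_left mult.assoc)
  also have "\<dots> = (\<Sum>j\<le>d. Const (c j) * V j)
      + Const (\<Sum>j\<le>d. c j * ((real (d choose j))\<^sup>2 / real (n choose j))) * (esym d n)\<^sup>2"
    by (simp add: sum.distrib Const_sum sum_distrib_right)
  also have "(\<Sum>j\<le>d. c j * ((real (d choose j))\<^sup>2 / real (n choose j)))
      = (\<Sum>j\<le>d. real (d choose j) / real (n choose j)) / real (d + 1)"
    unfolding sum_divide_distrib c_def
    by (intro sum.cong refl) (simp add: power2_eq_square divide_simps)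
  \<comment> \<open>The added terms vanish because \<open>d choose j = 0\<close> for
    \<open>j > d\<close>; the longer range fits \<open>sum_choose_ratio\<close>.\<close>
  also have "(\<Sum>j\<le>d. real (d choose j) / real (n choose j))
      = (\<Sum>j\<le>n. real (d choose j) / real (n choose j))"
    using assms by (intro sum.mono_neutral_left) (auto simp: not_le)
  also have "\<dots> = real (n + 1) / real (n + 1 - d)"
    by (rule sum_choose_ratio[OF assms])
  also have "(\<Sum>j\<le>d. Const (c j) * V j) = (\<Sum>(j, R)\<in>(SIGMA j:{..d}. subsets_of_card j n). Const (c j)
        * (esym_above d n R - Const (real (d choose j) / real (n choose j)) * esym d n)\<^sup>2)"
    unfolding V_def sum_distrib_left by (subst sum.Sigma) auto
  finally show ?thesis
    by (simp add: c_def mult.commute)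
qed

text \<open>Scaled by the outer binomials, the split-off coefficient is exactly the surplus from
  unequal normalisation. After expressing these binomials through \<open>n choose d\<close>, it
  reduces to \<open>(d + 1) * (n - d + 1) - d * (n - d) = n + 1\<close>.\<close>

lemma normalization_defect:
  assumes "1 \<le> d" "d < n"
  shows "1 / (real (n choose (d + 1)) * real (n choose (d - 1)))
      * (real (n + 1) / (real (d + 1) * real (n + 1 - d)))
    = 1 / (real (n choose (d + 1)) * real (n choose (d - 1))) - 1 / (real (n choose d))\<^sup>2"
proof -
  define B where "B = real (n choose d)"
  define u where "u = real (n choose (d + 1))"
  define l where "l = real (n choose (d - 1))"
  have pos: "B > 0" "u > 0" "l > 0"
    using assms by (auto simp: B_def u_def l_def)
  have "(d + 1) * (n choose (d + 1)) = (n - d) * (n choose d)"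
    using binomial_absorption[of d n] binomial_absorb_comp[of n d] by simp
  then have "real (d + 1) * u = real (n - d) * B"
    unfolding u_def B_def by (metis of_nat_mult)
  then have u: "u = (real n - real d) * B / (real d + 1)"
    using assms by (simp add: of_nat_diff field_simps)
  have "d * (n choose d) = (n - (d - 1)) * (n choose (d - 1))"
    using assms binomial_absorption[of "d - 1" n] binomial_absorb_comp[of n "d - 1"] by simp
  then have "real d * B = real (n - (d - 1)) * l"
    unfolding l_def B_def by (metis of_nat_mult)
  then have l: "l = real d * B / (real n - real d + 1)"
    using assms by (simp add: of_nat_diff field_simps)
  have "real d \<noteq> 0" "real n - real d \<noteq> 0" "real n - real d + 1 \<noteq> 0" "real d + 1 \<noteq> 0"
    using assms by auto
  moreover have "real (n + 1 - d) = real n - real d + 1"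
    using assms by (simp add: of_nat_diff)
  ultimately have "1 / (u * l) * (real (n + 1) / (real (d + 1) * real (n + 1 - d))) = 1 / (u * l) - 1 / B\<^sup>2"
    unfolding u l using pos(1) by (simp add: divide_simps power2_eq_square) (simp add: algebra_simps)
  then show ?thesis
    by (simp only: B_def u_def l_def)
qed

theorem corollary6p4:
  fixes d n :: nat
  assumes "1 \<le> d" and "d \<le> n - 1"
  shows "sum_of_squares n
    ((Const (1 / real (n choose d)) * esym d n)\<^sup>2
      - (Const (1 / real (n choose (d + 1))) * esym (d + 1) n)
        * (Const (1 / real (n choose (d - 1))) * esym (d - 1) n))"
proof -
  \<comment> \<open>The truncated \<open>n - 1\<close> is harmless: \<open>1 \<le> d\<close>
    excludes \<open>n = 0\<close>.\<close>
  have "d < n"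
    using assms by simp
  define a where "a = 1 / (real (n choose d))\<^sup>2"
  define b where "b = 1 / (real (n choose (d + 1)) * real (n choose (d - 1)))"
  \<comment> \<open>Weights and polynomials are indexed by pairs \<open>(j, R)\<close>, so that a
    single weighted sum covers all sizes \<open>j\<close>.\<close>
  define w where "w = (\<lambda>(j, R :: nat set). b * (1 / (real (d + 1) * real (d choose j))))"
  define q where "q = (\<lambda>(j, R). esym_above d n R - Const (real (d choose j) / real (n choose j)) * esym d n)"
  let ?A = "SIGMA j:{..d}. subsets_of_card j n"
  have "(Const (1 / real (n choose d)) * esym d n)\<^sup>2
      - (Const (1 / real (n choose (d + 1))) * esym (d + 1) n)
        * (Const (1 / real (n choose (d - 1))) * esym (d - 1) n)
      = Const a * (esym d n)\<^sup>2 - Const b * (esym (d + 1) n * esym (d - 1) n)"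
  proof -
    have "a = 1 / real (n choose d) * (1 / real (n choose d))"
      "b = 1 / real (n choose (d + 1)) * (1 / real (n choose (d - 1)))"
      by (simp_all add: a_def b_def power2_eq_square)
    then show ?thesis
      by (simp only: Const_mult power2_eq_square mult_ac)
  qed
  also have "\<dots> = Const b * gram_form d n - Const (b - a) * (esym d n)\<^sup>2"
    unfolding esym_mult_neighbours[OF assms(1)] by (simp add: Const_diff algebra_simps)
  also have "\<dots> = Const b * (\<Sum>(j, R)\<in>?A. Const (1 / (real (d + 1) * real (d choose j))) * (q (j, R))\<^sup>2)"
  proof -
    \<comment> \<open>This makes the squares of \<open>esym d n\<close> cancel, leaving only the
      squared deviations.\<close>
    have "Const (b - a) = Const b * Const (real (n + 1) / (real (d + 1) * real (n + 1 - d)))"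
      unfolding Const_mult[symmetric] a_def b_def normalization_defect[OF assms(1) \<open>d < n\<close>] ..
    then show ?thesis
      using \<open>d < n\<close> by (simp add: gram_form_deviation q_def distrib_left mult.assoc del: of_nat_add)
  qed
  also have "\<dots> = (\<Sum>z\<in>?A. Const (w z) * (q z)\<^sup>2)"
    unfolding sum_distrib_left
    by (intro sum.cong refl) (clarsimp simp only: w_def Const_mult mult.assoc split_conv)
  also have "sum_of_squares n \<dots>"
    by (intro sum_of_squares_weighted_sum)
       (auto simp: w_def q_def b_def intro!: polys_diff polys_mult esym_in_polys esym_above_in_polys)
  finally show ?thesis .
qed

end
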